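(* Let $X$ be a separable infinite-dimensional reflexive Banach space, let $N\geq 2$ be an integer, and let $T_1,\dots,T_N$ be continuous linear operators on $X$. The following are equivalent: (1) $T_1,\dots,T_N$ are disjoint hypercyclic and each $T_i$ is reiteratively hypercyclic; (2) $T_1,\dots,T_N$ are disjoint reiteratively hypercyclic.
   Context: For $T\in\mathcal{L}(X)$, $x\in X$ and $U\subset X$, $N(x,U)=\{n\in\mathbb{N}:T^nx\in U\}$. The upper Banach density of $A\subset\mathbb{N}$ is $\overline{Bd}(A)=\lim_{N\to\infty}\limsup_{m\to\infty}\frac{\#(A\cap[m+1,m+N])}{N}$. A vector $x$ is reiteratively hypercyclic for $T$ if $\overline{Bd}(N(x,U))>0$ for every non-empty open $U\subset X$; $T$ is reiteratively hypercyclic if it has such a vector. Operators $T_1,\dots,T_N$ ($N\ge2$) are disjoint hypercyclic (resp. disjoint reiteratively hypercyclic) if the direct sum $T_1\oplus\cdots\oplus T_N$ on $X^N$ has a hypercyclic (resp. reiteratively hypercyclic) vector of the form $(x,\dots,x)$; a vector $y$ is hypercyclic for an operator $S$ if its orbit $\{S^ny:n\in\mathbb{N}\}$ is dense. *)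

theory Defs
  imports "HOL-Analysis.Analysis"
begin

definition return_times :: "('b \<Rightarrow> 'b) \<Rightarrow> 'b \<Rightarrow> 'b set \<Rightarrow> nat set" where
  "return_times S x U = {n. (S ^^ n) x \<in> U}"

definition upper_banach_density :: "nat set \<Rightarrow> ereal" where
  "upper_banach_density A =
     lim (\<lambda>N. limsup (\<lambda>m. ereal (real (card (A \<inter> {m+1..m+N})) / real N)))"

definition hypercyclic_vector :: "('b::topological_space \<Rightarrow> 'b) \<Rightarrow> 'b \<Rightarrow> bool" where
  "hypercyclic_vector S y \<longleftrightarrow> closure (range (\<lambda>n. (S ^^ n) y)) = UNIV"

definition reit_hypercyclic_vector :: "('b::topological_space \<Rightarrow> 'b) \<Rightarrow> 'b \<Rightarrow> bool" where
  "reit_hypercyclic_vector S x \<longleftrightarrow>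
     (\<forall>U. open U \<and> U \<noteq> {} \<longrightarrow> upper_banach_density (return_times S x U) > 0)"

definition reit_hypercyclic :: "('a::real_normed_vector \<Rightarrow>\<^sub>L 'a) \<Rightarrow> bool" where
  "reit_hypercyclic T \<longleftrightarrow> (\<exists>x. reit_hypercyclic_vector (blinfun_apply T) x)"

text \<open>Direct sum T_1 \<oplus> ... \<oplus> T_N acting on X^N, where X^N is the function
  space 'n \<Rightarrow> 'a (finite index type 'n, product topology).\<close>
definition direct_sum_op :: "('n \<Rightarrow> ('a::real_normed_vector \<Rightarrow>\<^sub>L 'a)) \<Rightarrow> ('n \<Rightarrow> 'a) \<Rightarrow> ('n \<Rightarrow> 'a)" where
  "direct_sum_op T y = (\<lambda>i. blinfun_apply (T i) (y i))"

definition disjoint_hypercyclic :: "('n \<Rightarrow> ('a::real_normed_vector \<Rightarrow>\<^sub>L 'a)) \<Rightarrow> bool" where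
  "disjoint_hypercyclic T \<longleftrightarrow> (\<exists>x. hypercyclic_vector (direct_sum_op T) (\<lambda>_. x))"

definition disjoint_reit_hypercyclic :: "('n \<Rightarrow> ('a::real_normed_vector \<Rightarrow>\<^sub>L 'a)) \<Rightarrow> bool" where
  "disjoint_reit_hypercyclic T \<longleftrightarrow> (\<exists>x. reit_hypercyclic_vector (direct_sum_op T) (\<lambda>_. x))"

definition separable_space :: "'a::topological_space itself \<Rightarrow> bool" where
  "separable_space _ \<longleftrightarrow> (\<exists>D::'a set. countable D \<and> closure D = UNIV)"

definition infinite_dimensional :: "'a::real_vector itself \<Rightarrow> bool" where
  "infinite_dimensional _ \<longleftrightarrow> \<not> (\<exists>S::'a set. finite S \<and> span S = UNIV)"

definition reflexive_space :: "'a::real_normed_vector itself \<Rightarrow> bool" where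
  "reflexive_space _ \<longleftrightarrow>
     (\<forall>\<phi> :: ('a \<Rightarrow>\<^sub>L real) \<Rightarrow>\<^sub>L real. \<exists>x::'a. \<forall>f. blinfun_apply \<phi> f = blinfun_apply f x)"

end

theory Submission
  imports Defs
begin

text \<open>Positivity of the upper Banach density only concerns arbitrarily long finite windows, which may
  be translated freely. If sets \<open>A\<^sub>1, \<dots>, A\<^sub>N\<close> have positive density, averaging over independent
  translations produces, for every length \<open>M\<close>, shifts \<open>s\<^sub>1, \<dots>, s\<^sub>N\<close> such that the sets
  \<open>A\<^sub>i - s\<^sub>i\<close> have at least \<open>\<epsilon> M\<close> common points in \<open>[1, M]\<close>, with \<open>\<epsilon>\<close> independent of \<open>M\<close>.
  Apply this to the return times \<open>A\<^sub>i\<close> of a reiteratively hypercyclic vector \<open>x\<^sub>i\<close> of \<open>T\<^sub>i\<close> to an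
  open set \<open>V\<^sub>i\<close>: the orbit of \<open>(T\<^sub>i\<^bsup>s\<^sub>i\<^esup> x\<^sub>i)\<^sub>i\<close> under the direct sum visits \<open>V\<^sub>1 \<times> \<dots> \<times> V\<^sub>N\<close> at least
  \<open>\<epsilon> M\<close> times in \<open>[1, M]\<close>, and by continuity a hypercyclic vector of the direct sum follows this
  finite piece of orbit arbitrarily late.\<close>

section \<open>Positive upper Banach density\<close>

text \<open>Fekete's lemma: the limit is the infimum of the quotients. The last two clauses make
  \<open>L\<close> the largest slope of a linear lower bound for \<open>a\<close>, which later turns
  positivity of the density into a condition on windows.\<close>

lemma subadditive_quotient_tendsto:
  fixes a :: "nat \<Rightarrow> nat"
  assumes sub: "\<And>m n. a (m + n) \<le> a m + a n" and le: "\<And>n. a n \<le> n"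
  obtains L where "(\<lambda>n. real (a n) / real n) \<longlonglongrightarrow> L"
    and "\<And>n. L * real n \<le> real (a n)"
    and "\<And>d. (\<And>n. d * real n \<le> real (a n)) \<Longrightarrow> d \<le> L"
proof -
  \<comment> \<open>Index 0 is excluded because \<open>x / 0 = 0\<close> would force the infimum
    down to 0.\<close>
  define Q where "Q = (\<lambda>n. real (a n) / real n) ` {1..}"
  have bdd: "bdd_below Q"
    unfolding Q_def by (rule bdd_belowI[where m=0]) auto
  have ne: "Q \<noteq> {}"
    by (auto simp: Q_def)
  have lower: "Inf Q * real n \<le> real (a n)" for n
  proof (cases "n = 0")
    case False
    then have "Inf Q \<le> real (a n) / real n"
      by (intro cInf_lower[OF _ bdd]) (auto simp: Q_def)
    with False show ?thesis by (simp add: field_simps)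
  qed simp
  have greatest: "d \<le> Inf Q" if "\<And>n. d * real n \<le> real (a n)" for d
    using ne that by (intro cInf_greatest) (auto simp: Q_def field_simps)
  have mult: "a (q * p + r) \<le> q * a p + r" for q p r
  proof (induction q)
    case 0
    show ?case using le by simp
  next
    case (Suc q)
    have "a (Suc q * p + r) \<le> a p + a (q * p + r)"
      using sub[of p "q * p + r"] by (simp add: add.assoc)
    with Suc show ?case by simp
  qed
  \<comment> \<open>Divide \<open>n\<close> by \<open>p\<close> with remainder: the full blocks cost
    at most \<open>a p\<close> each, and the remainder costs at most \<open>p\<close>, which is
    negligible against \<open>n\<close>.\<close>
  have upper: "real (a n) / real n \<le> real (a p) / real p + real p / real n"
    if "p > 0" "n > 0" for n p
  proof -
    have "a n \<le> (n div p) * a p + n mod p"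
      using mult[of "n div p" p "n mod p"] by simp
    moreover have "n mod p \<le> p"
      using that by (simp add: less_imp_le)
    ultimately have "a n \<le> (n div p) * a p + p"
      by linarith
    then have "real (a n) \<le> real ((n div p) * a p + p)"
      by (simp only: of_nat_le_iff)
    also have "\<dots> = real (n div p) * real (a p) + real p"
      by simp
    also have "\<dots> \<le> real n / real p * real (a p) + real p"
      by (intro add_right_mono mult_right_mono of_nat_div_le_of_nat) auto
    finally show ?thesis
      using that by (simp add: field_simps)
  qed
  have "(\<lambda>n. real (a n) / real n) \<longlonglongrightarrow> Inf Q"
  proof (rule LIMSEQ_I)
    fix e :: real assume e: "e > 0"
    obtain p where p: "p > 0" "real (a p) / real p < Inf Q + e / 2"
    proof -
      obtain q where q: "q \<in> Q" "q < Inf Q + e / 2"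
        using cInf_lessD[OF ne, of "Inf Q + e / 2"] e by auto
      from q(1) obtain p where "p \<ge> 1" "q = real (a p) / real p"
        unfolding Q_def by blast
      with q(2) show ?thesis
        by (intro that[of p]) simp_all
    qed
    obtain K where "2 * real p / e < real K"
      using reals_Archimedean2 by blast
    with e have pK: "2 * real p < e * real K"
      by (simp add: pos_divide_less_eq mult.commute)
    with p(1) e have K: "K > 0"
      by (cases K) auto
    with pK have pK: "real p / real K < e / 2"
      by (simp add: field_simps)
    show "\<exists>no. \<forall>n\<ge>no. norm (real (a n) / real n - Inf Q) < e"
    proof (intro exI allI impI)
      fix n assume n: "n \<ge> K"
      have "real (a n) / real n \<le> real (a p) / real p + real p / real n"
        using upper p(1) K n by simp
      also have "real p / real n \<le> real p / real K"
        using n K by (intro divide_left_mono) auto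
      also note pK
      also note p(2)
      finally have "real (a n) / real n < Inf Q + e"
        by simp
      moreover have "Inf Q \<le> real (a n) / real n"
        using lower[of n] n K by (simp add: field_simps)
      ultimately show "norm (real (a n) / real n - Inf Q) < e"
        by simp
    qed
  qed
  then show ?thesis
    using lower greatest by (rule that)
qed

text \<open>The limsup over windows of length \<open>N\<close> is subadditive in \<open>N\<close>,
  so Fekete's lemma identifies the density with the best slope \<open>d\<close> valid for all
  \<open>N\<close>. This removes both limits from all later arguments.\<close>

lemma upper_banach_density_pos_iff:
  "upper_banach_density A > 0 \<longleftrightarrow>
    (\<exists>d>0. \<forall>N. \<exists>\<^sub>\<infinity>m. d * real N \<le> real (card (A \<inter> {m+1..m+N})))"
proof -
  define c where "c N m = card (A \<inter> {m+1..m+N})" for N m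
  \<comment> \<open>Window counts are integers in \<open>[0, N]\<close>, so their limsup is the
    largest \<open>k\<close> that is reached or exceeded infinitely often.\<close>
  define a where "a N = Max {k. \<exists>\<^sub>\<infinity>m. k \<le> c N m}" for N
  have c_le: "c N m \<le> N" for N m
    unfolding c_def using card_mono[of "{m+1..m+N}" "A \<inter> {m+1..m+N}"] by simp
  have fin: "finite {k. \<exists>\<^sub>\<infinity>m. k \<le> c N m}" for N
    by (rule finite_subset[of _ "{..N}"]) (auto dest!: INFM_EX intro: order_trans[OF _ c_le])
  have "a N \<in> {k. \<exists>\<^sub>\<infinity>m. k \<le> c N m}" for N
    unfolding a_def by (rule Max_in[OF fin]) (auto simp: INFM_nat)
  then have inf: "\<exists>\<^sub>\<infinity>m. a N \<le> c N m" for N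
    by simp
  have ev: "\<forall>\<^sub>\<infinity>m. c N m \<le> a N" for N
  proof (rule ccontr)
    assume "\<not> ?thesis"
    then have "\<exists>\<^sub>\<infinity>m. Suc (a N) \<le> c N m"
      by (simp add: not_MOST not_le Suc_le_eq)
    then have "Suc (a N) \<le> a N"
      unfolding a_def[of N] using fin by (intro Max_ge) (auto simp: a_def)
    then show False by simp
  qed
  have a_le: "a N \<le> N" for N
    using inf[of N] c_le by (auto dest!: INFM_EX intro: order_trans)
  have c_add: "c (M + N) m = c M m + c N (m + M)" for M N m
  proof -
    have "A \<inter> {m+1..m+(M+N)} = (A \<inter> {m+1..m+M}) \<union> (A \<inter> {m+M+1..m+M+N})"
      by auto
    then show ?thesis
      unfolding c_def by (simp only:) (rule card_Un_disjoint; auto)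
  qed
  \<comment> \<open>Split a rich window of length \<open>M + N\<close> into two; far enough out,
    neither part can exceed its eventual bound.\<close>
  have sub: "a (M + N) \<le> a M + a N" for M N
  proof -
    have "\<forall>\<^sub>\<infinity>m. c N (m + M) \<le> a N"
      using ev[of N] unfolding MOST_nat_le by (meson trans_le_add1)
    with inf[of "M + N"] ev[of M]
    have "\<exists>\<^sub>\<infinity>m. a (M + N) \<le> c (M + N) m \<and> c M m \<le> a M \<and> c N (m + M) \<le> a N"
      by (intro INFM_conjI) (simp_all add: MOST_conj_distrib)
    then show ?thesis
      by (auto dest!: INFM_EX simp: c_add)
  qed
  have limsup: "limsup (\<lambda>m. ereal (real (c N m) / real N)) = ereal (real (a N) / real N)" for N
  proof (rule antisym)
    show "limsup (\<lambda>m. ereal (real (c N m) / real N)) \<le> ereal (real (a N) / real N)"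
      using ev[of N]
      by (intro Limsup_bounded) (auto simp: cofinite_eq_sequentially divide_right_mono elim: eventually_mono)
    show "ereal (real (a N) / real N) \<le> limsup (\<lambda>m. ereal (real (c N m) / real N))"
    proof (rule ccontr)
      assume "\<not> ?thesis"
      then have "\<forall>\<^sub>F m in sequentially. ereal (real (c N m) / real N) < ereal (real (a N) / real N)"
        by (intro Limsup_lessD) simp
      then have "\<forall>\<^sub>\<infinity>m. \<not> a N \<le> c N m"
        unfolding cofinite_eq_sequentially
        by (rule eventually_mono) (auto simp: not_le divide_less_cancel)
      with inf[of N] show False
        by (simp add: not_INFM[symmetric] del: not_INFM)
    qed
  qed
  obtain L where L: "(\<lambda>n. real (a n) / real n) \<longlonglongrightarrow> L" "\<And>n. L * real n \<le> real (a n)"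
      "\<And>d. (\<And>n. d * real n \<le> real (a n)) \<Longrightarrow> d \<le> L"
    using subadditive_quotient_tendsto[of a, OF sub a_le] by blast
  have "upper_banach_density A = ereal L"
    unfolding upper_banach_density_def c_def[symmetric] limsup
    using L(1) by (intro limI) simp
  then have "upper_banach_density A > 0 \<longleftrightarrow> L > 0"
    by simp
  also have "\<dots> \<longleftrightarrow> (\<exists>d>0. \<forall>N. \<exists>\<^sub>\<infinity>m. d * real N \<le> real (c N m))"
  proof
    assume "L > 0"
    moreover have "\<exists>\<^sub>\<infinity>m. L * real N \<le> real (c N m)" for N
      using inf[of N] by (rule INFM_mono) (use L(2)[of N] in simp)
    ultimately show "\<exists>d>0. \<forall>N. \<exists>\<^sub>\<infinity>m. d * real N \<le> real (c N m)"
      by blast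
  next
    assume "\<exists>d>0. \<forall>N. \<exists>\<^sub>\<infinity>m. d * real N \<le> real (c N m)"
    then obtain d where d: "d > 0" "\<And>N. \<exists>\<^sub>\<infinity>m. d * real N \<le> real (c N m)"
      by blast
    have "d * real N \<le> real (a N)" for N
    proof -
      obtain m where "d * real N \<le> real (c N m)" "c N m \<le> a N"
        using INFM_EX[OF INFM_conjI[OF d(2)[of N] ev[of N]]] by blast
      then show ?thesis by linarith
    qed
    then show "L > 0"
      using L(3) d(1) by (meson less_le_trans)
  qed
  finally show ?thesis
    unfolding c_def .
qed

text \<open>Double counting of pairs of a time \<open>n\<close> and a shift vector \<open>s\<close>.
  The bound \<open>k\<close> lets the resulting pattern be placed late on an orbit.\<close>

lemma exists_shifts_dense_intersection:
  fixes A :: "'n::finite \<Rightarrow> nat set"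
  assumes "\<And>i. upper_banach_density (A i) > 0"
  obtains e where "e > 0"
    and "\<And>M k. \<exists>s. (\<forall>i. k \<le> s i) \<and> e * real M \<le> real (card {n \<in> {1..M}. \<forall>i. n + s i \<in> A i})"
proof -
  have "\<forall>i. \<exists>d>0. \<forall>N. \<exists>\<^sub>\<infinity>m. d * real N \<le> real (card (A i \<inter> {m+1..m+N}))"
    using assms by (simp add: upper_banach_density_pos_iff)
  then obtain d where d: "\<And>i. d i > 0"
      "\<And>i N. \<exists>\<^sub>\<infinity>m. d i * real N \<le> real (card (A i \<inter> {m+1..m+N}))"
    using choice[of "\<lambda>i d. d > 0 \<and> (\<forall>N. \<exists>\<^sub>\<infinity>m. d * real N \<le> real (card (A i \<inter> {m+1..m+N})))"]
    by blast
  \<comment> \<open>Half of each \<open>d i\<close> is given up to absorb the boundary loss when a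
    window is translated by at most \<open>M\<close>.\<close>
  define e where "e = (\<Prod>i\<in>UNIV. d i / 2)"
  have "e > 0"
    unfolding e_def using d(1) by (intro prod_pos) simp
  moreover have "\<exists>s. (\<forall>i. k \<le> s i) \<and>
      e * real M \<le> real (card {n \<in> {1..M}. \<forall>i. n + s i \<in> A i})" for M k
  proof -
    \<comment> \<open>One window length for all \<open>i\<close>, so large that losing
      \<open>M\<close> points costs at most half of \<open>d i * L\<close>.\<close>
    obtain L :: nat where "Max (range (\<lambda>i. 2 * real M / d i)) < real L"
      using reals_Archimedean2 by blast
    then have less_L: "2 * real M / d i < real L" for i
      by (simp add: Max_less_iff)
    have L: "real M \<le> d i / 2 * real L" for i
      using less_L[of i] d(1)[of i] by (simp add: pos_divide_less_eq less_imp_le mult.commute)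
    \<comment> \<open>Any index would do here; \<open>L > 0\<close> makes the box \<open>P\<close>
      of shift vectors nonempty.\<close>
    have "0 \<le> 2 * real M / d undefined"
      using d(1)[of undefined] by simp
    with less_L[of undefined] have L0: "L > 0"
      by linarith
    have "\<forall>i. \<exists>m\<ge>k. d i * real L \<le> real (card (A i \<inter> {m+1..m+L}))"
      using d(2) unfolding INFM_nat_le by blast
    then obtain m where m: "\<And>i. m i \<ge> k"
        "\<And>i. d i * real L \<le> real (card (A i \<inter> {m i+1..m i+L}))"
      by metis
    define P where "P = (\<Pi>\<^sub>E i\<in>UNIV. {m i+1..m i+L})"
    have finP: "finite P"
      unfolding P_def by (intro finite_PiE) auto
    have cardP: "card P = L ^ CARD('n)"
      unfolding P_def by (subst card_PiE) auto
    define f where "f s = card {n \<in> {1..M}. \<forall>i. n + s i \<in> A i}" for s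
    \<comment> \<open>Translation by \<open>n\<close> loses only points among the first
      \<open>n\<close> of the window, hence at most \<open>M\<close> of them.\<close>
    have good: "d i / 2 * real L \<le> real (card {s \<in> {m i+1..m i+L}. n + s \<in> A i})"
      if n: "n \<in> {1..M}" for i n
    proof -
      have "A i \<inter> {m i+1..m i+L} \<subseteq>
          {m i+1..m i+n} \<union> (\<lambda>s. n + s) ` {s \<in> {m i+1..m i+L}. n + s \<in> A i}" (is "_ \<subseteq> _ \<union> ?R")
      proof
        fix x assume x: "x \<in> A i \<inter> {m i+1..m i+L}"
        show "x \<in> {m i+1..m i+n} \<union> ?R"
        proof (cases "x \<le> m i + n")
          case False
          then have "x = n + (x - n)" "x - n \<in> {m i+1..m i+L}"
            using x by auto
          moreover from this x have "n + (x - n) \<in> A i"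
            by simp
          ultimately show ?thesis by blast
        qed (use x in auto)
      qed
      then have "card (A i \<inter> {m i+1..m i+L}) \<le> card ({m i+1..m i+n} \<union> ?R)"
        by (intro card_mono) auto
      also have "\<dots> \<le> card {m i+1..m i+n} + card ?R"
        by (rule card_Un_le)
      also have "card ?R = card {s \<in> {m i+1..m i+L}. n + s \<in> A i}"
        by (intro card_image inj_onI) simp
      finally have "real (card (A i \<inter> {m i+1..m i+L})) \<le>
          real M + real (card {s \<in> {m i+1..m i+L}. n + s \<in> A i})"
        using n by simp
      then show ?thesis
        using m(2)[of i] L[of i] by simp
    qed
    have "e * real M * real (card P) = (\<Sum>n\<in>{1..M}. \<Prod>i\<in>UNIV. d i / 2 * real L)"
      by (simp add: cardP e_def prod.distrib prod_dividef field_simps)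
    also have "\<dots> \<le> (\<Sum>n\<in>{1..M}. \<Prod>i\<in>UNIV. real (card {s \<in> {m i+1..m i+L}. n + s \<in> A i}))"
      using good d(1) by (intro sum_mono prod_mono conjI) (simp_all add: less_imp_le)
    \<comment> \<open>For fixed \<open>n\<close> the conditions on the coordinates of
      \<open>s\<close> are independent, so the good shift vectors form a box.\<close>
    also have "\<dots> = (\<Sum>n\<in>{1..M}. real (card {s\<in>P. \<forall>i. n + s i \<in> A i}))"
    proof (intro sum.cong refl)
      fix n
      have "{s\<in>P. \<forall>i. n + s i \<in> A i} = (\<Pi>\<^sub>E i\<in>UNIV. {s \<in> {m i+1..m i+L}. n + s \<in> A i})"
        by (auto simp: P_def PiE_iff)
      then show "(\<Prod>i\<in>UNIV. real (card {s \<in> {m i+1..m i+L}. n + s \<in> A i})) =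
          real (card {s\<in>P. \<forall>i. n + s i \<in> A i})"
        by (simp add: card_PiE)
    qed
    also have "\<dots> = (\<Sum>s\<in>P. real (f s))"
      unfolding f_def of_nat_sum[symmetric]
      by (subst sum_multicount_gen[of "{1..M}" P "\<lambda>n s. \<forall>i. n + s i \<in> A i"]) (auto simp: finP)
    finally have avg: "e * real M * real (card P) \<le> (\<Sum>s\<in>P. real (f s))" .
    have "\<exists>s\<in>P. e * real M \<le> real (f s)"
    proof (rule ccontr)
      assume "\<not> ?thesis"
      then have "(\<Sum>s\<in>P. real (f s)) < real (card P) * (e * real M)"
        using finP cardP L0 by (intro sum_bounded_above_strict) (auto simp: not_le)
      with avg show False by (simp add: mult.commute)
    qed
    then obtain s where "s \<in> P" "e * real M \<le> real (f s)"
      by blast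
    moreover from \<open>s \<in> P\<close> have "k \<le> s i" for i
      using m(1)[of i] by (auto simp: P_def PiE_iff dest!: spec[of _ i])
    ultimately show ?thesis
      unfolding f_def by blast
  qed
  ultimately show ?thesis
    by (rule that)
qed

section \<open>Orbits of hypercyclic vectors\<close>

lemma continuous_on_funpow:
  fixes S :: "'b::topological_space \<Rightarrow> 'b"
  assumes "continuous_on UNIV S"
  shows "continuous_on UNIV (S ^^ n)"
proof (induction n)
  case (Suc n)
  then show ?case
    using continuous_on_compose2[OF assms Suc] by (simp add: comp_def)
qed (simp add: id_def)

text \<open>A finite visiting pattern is an open condition on the starting point, so the dense orbit
  of \<open>y\<close> enters it and repeats the pattern. The offset \<open>k\<close> makes the copy
  late whatever the entry time \<open>j\<close> is.\<close>

lemma upper_banach_density_return_times_pos: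
  fixes S :: "'b::topological_space \<Rightarrow> 'b"
  assumes cont: "continuous_on UNIV S" and hc: "hypercyclic_vector S y" and "open U" and "e > 0"
    and pieces: "\<And>M k. \<exists>z. e * real M \<le> real (card {n \<in> {1..M}. (S ^^ (n + k)) z \<in> U})"
  shows "upper_banach_density (return_times S y U) > 0"
  unfolding upper_banach_density_pos_iff
proof (intro exI[of _ e] conjI allI)
  fix M
  show "\<exists>\<^sub>\<infinity>m. e * real M \<le> real (card (return_times S y U \<inter> {m+1..m+M}))"
    unfolding INFM_nat_le
  proof
    fix k
    obtain z where z: "e * real M \<le> real (card {n \<in> {1..M}. (S ^^ (n + k)) z \<in> U})"
      using pieces by blast
    define F where "F = {n \<in> {1..M}. (S ^^ (n + k)) z \<in> U}"
    define W where "W = (\<Inter>n\<in>F. (S ^^ (n + k)) -` U)"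
    have "open W"
      unfolding W_def F_def using continuous_on_funpow[OF cont] \<open>open U\<close>
      by (intro open_INT) (auto intro: open_vimage)
    moreover have "z \<in> W"
      by (auto simp: W_def F_def)
    moreover have "z \<in> closure (range (\<lambda>n. (S ^^ n) y))"
      using hc by (simp add: hypercyclic_vector_def)
    ultimately obtain j where j: "(S ^^ j) y \<in> W"
      by (auto simp: closure_iff_nhds_not_empty)
    have "(\<lambda>n. n + (k + j)) ` F \<subseteq> return_times S y U \<inter> {k+j+1..k+j+M}"
    proof
      fix x assume "x \<in> (\<lambda>n. n + (k + j)) ` F"
      then obtain n where n: "n \<in> F" "x = (n + k) + j"
        by auto
      then have "(S ^^ x) y = (S ^^ (n + k)) ((S ^^ j) y)"
        by (simp only: funpow_add o_apply)
      with j n show "x \<in> return_times S y U \<inter> {k+j+1..k+j+M}"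
        by (auto simp: return_times_def W_def F_def)
    qed
    then have "card ((\<lambda>n. n + (k + j)) ` F) \<le> card (return_times S y U \<inter> {k+j+1..k+j+M})"
      by (intro card_mono) auto
    moreover have "card ((\<lambda>n. n + (k + j)) ` F) = card F"
      by (intro card_image inj_onI) simp
    ultimately show "\<exists>m\<ge>k. e * real M \<le> real (card (return_times S y U \<inter> {m+1..m+M}))"
      using z unfolding F_def by (intro exI[of _ "k + j"]) linarith
  qed
qed (fact \<open>e > 0\<close>)

text \<open>A window of length 1 with positive count already contains a return time.\<close>

lemma reit_hypercyclic_vector_imp_hypercyclic_vector:
  assumes "reit_hypercyclic_vector S y"
  shows "hypercyclic_vector S y"
proof -
  have "\<exists>n. (S ^^ n) y \<in> U" if U: "open U" "U \<noteq> {}" for U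
  proof -
    obtain d where d: "d > 0"
        "\<And>N. \<exists>\<^sub>\<infinity>m. d * real N \<le> real (card (return_times S y U \<inter> {m+1..m+N}))"
      using assms U unfolding reit_hypercyclic_vector_def upper_banach_density_pos_iff by blast
    obtain m where "d * real 1 \<le> real (card (return_times S y U \<inter> {m+1..m+1}))"
      using INFM_EX[OF d(2)] by blast
    with d(1) have "return_times S y U \<inter> {m+1..m+1} \<noteq> {}"
      by (metis card.empty mult.right_neutral not_less of_nat_0 of_nat_1)
    then show ?thesis
      unfolding return_times_def by blast
  qed
  then show ?thesis
    unfolding hypercyclic_vector_def
    by (fastforce simp: closure_iff_nhds_not_empty)
qed

section \<open>Direct sums on the product space\<close>

lemma direct_sum_op_funpow:
  "(direct_sum_op T ^^ n) y = (\<lambda>i. (blinfun_apply (T i) ^^ n) (y i))"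
  by (induction n) (auto simp: direct_sum_op_def)

lemma continuous_on_direct_sum_op:
  "continuous_on UNIV (direct_sum_op T)"
  unfolding direct_sum_op_def
  by (intro continuous_on_coordinatewise_then_product continuous_intros
      continuous_on_product_coordinates)

text \<open>The cylinder over \<open>U\<close> in coordinate \<open>i\<close> has exactly the return
  times of \<open>U\<close>.\<close>

lemma reit_hypercyclic_vector_direct_sum_op_component:
  fixes T :: "'n \<Rightarrow> ('a::real_normed_vector \<Rightarrow>\<^sub>L 'a)"
  assumes "reit_hypercyclic_vector (direct_sum_op T) y"
  shows "reit_hypercyclic_vector (blinfun_apply (T i)) (y i)"
  unfolding reit_hypercyclic_vector_def
proof (intro allI impI)
  fix U :: "'a set" assume U: "open U \<and> U \<noteq> {}"
  define V where "V = (\<lambda>z::'n \<Rightarrow> 'a. z i) -` U"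
  have "open V"
    unfolding V_def using U by (intro open_vimage continuous_on_product_coordinates) auto
  moreover have "V \<noteq> {}"
    using U by (auto simp: V_def)
  moreover have "return_times (direct_sum_op T) y V = return_times (blinfun_apply (T i)) (y i) U"
    by (auto simp: return_times_def V_def direct_sum_op_funpow)
  ultimately show "upper_banach_density (return_times (blinfun_apply (T i)) (y i) U) > 0"
    using assms unfolding reit_hypercyclic_vector_def by metis
qed

text \<open>Vectors \<open>x i\<close>, chosen separately for each \<open>T i\<close>, supply dense
  visiting patterns to a box inside \<open>U\<close>; the orbit of \<open>y\<close> then copies
  them.\<close>

lemma reit_hypercyclic_vector_direct_sum_op:
  fixes T :: "'n::finite \<Rightarrow> ('a::real_normed_vector \<Rightarrow>\<^sub>L 'a)"
  assumes hc: "hypercyclic_vector (direct_sum_op T) y" and reit: "\<And>i. reit_hypercyclic (T i)"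
  shows "reit_hypercyclic_vector (direct_sum_op T) y"
  unfolding reit_hypercyclic_vector_def
proof (intro allI impI)
  fix U :: "('n \<Rightarrow> 'a) set" assume U: "open U \<and> U \<noteq> {}"
  then obtain u where "u \<in> U"
    by auto
  then obtain V where V: "u \<in> (\<Pi>\<^sub>E i\<in>UNIV. V i)" "\<And>i. open (V i)" "(\<Pi>\<^sub>E i\<in>UNIV. V i) \<subseteq> U"
    using product_topology_open_contains_basis[of "\<lambda>_. euclidean" UNIV U u] U
    by (auto simp: open_fun_def)
  obtain x where x: "\<And>i. reit_hypercyclic_vector (blinfun_apply (T i)) (x i)"
    using reit unfolding reit_hypercyclic_def by metis
  define A where "A i = return_times (blinfun_apply (T i)) (x i) (V i)" for i
  have "upper_banach_density (A i) > 0" for i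
    using x[of i] V(1,2) unfolding reit_hypercyclic_vector_def A_def by (auto simp: PiE_iff)
  then obtain e where e: "e > 0"
      "\<And>M k. \<exists>s. (\<forall>i. k \<le> s i) \<and> e * real M \<le> real (card {n \<in> {1..M}. \<forall>i. n + s i \<in> A i})"
    using exists_shifts_dense_intersection[of A] by blast
  show "upper_banach_density (return_times (direct_sum_op T) y U) > 0"
  proof (rule upper_banach_density_return_times_pos[OF continuous_on_direct_sum_op hc _ e(1)])
    fix M k
    obtain s where s: "\<And>i. k \<le> s i"
        "e * real M \<le> real (card {n \<in> {1..M}. \<forall>i. n + s i \<in> A i})"
      using e(2) by blast
    \<comment> \<open>Coordinate \<open>i\<close> starts \<open>s i - k\<close> steps along the
      orbit of \<open>x i\<close>, so time \<open>n + k\<close> for \<open>z\<close> is time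
      \<open>n + s i\<close> for \<open>x i\<close>; the subtraction is exact since
      \<open>k \<le> s i\<close>.\<close>
    define z where "z = (\<lambda>i. (blinfun_apply (T i) ^^ (s i - k)) (x i))"
    have "(direct_sum_op T ^^ (n + k)) z = (\<lambda>i. (blinfun_apply (T i) ^^ (n + s i)) (x i))" for n
    proof
      fix i
      have "n + s i = (n + k) + (s i - k)"
        using s(1)[of i] by simp
      then show "(direct_sum_op T ^^ (n + k)) z i = (blinfun_apply (T i) ^^ (n + s i)) (x i)"
        by (simp only: direct_sum_op_funpow z_def funpow_add o_apply)
    qed
    then have "{n \<in> {1..M}. \<forall>i. n + s i \<in> A i} \<subseteq>
        {n \<in> {1..M}. (direct_sum_op T ^^ (n + k)) z \<in> U}"
      using V(3) by (auto simp: A_def return_times_def PiE_iff subset_iff)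
    then have "card {n \<in> {1..M}. \<forall>i. n + s i \<in> A i} \<le>
        card {n \<in> {1..M}. (direct_sum_op T ^^ (n + k)) z \<in> U}"
      by (intro card_mono) auto
    with s(2) show "\<exists>z. e * real M \<le> real (card {n \<in> {1..M}. (direct_sum_op T ^^ (n + k)) z \<in> U})"
      by (intro exI[of _ z]) linarith
  qed (use U in blast)
qed

theorem theorem3p4:
  fixes T :: "'n::finite \<Rightarrow> ('a::banach \<Rightarrow>\<^sub>L 'a)"
  assumes "separable_space TYPE('a)"
    and "infinite_dimensional TYPE('a)"
    and "reflexive_space TYPE('a)"
    and "CARD('n) \<ge> 2"
  shows "(disjoint_hypercyclic T \<and> (\<forall>i. reit_hypercyclic (T i)))
         \<longleftrightarrow> disjoint_reit_hypercyclic T"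
proof
  assume "disjoint_hypercyclic T \<and> (\<forall>i. reit_hypercyclic (T i))"
  then show "disjoint_reit_hypercyclic T"
    unfolding disjoint_hypercyclic_def disjoint_reit_hypercyclic_def
    using reit_hypercyclic_vector_direct_sum_op by blast
next
  assume "disjoint_reit_hypercyclic T"
  then show "disjoint_hypercyclic T \<and> (\<forall>i. reit_hypercyclic (T i))"
    unfolding disjoint_hypercyclic_def disjoint_reit_hypercyclic_def reit_hypercyclic_def
    by (metis reit_hypercyclic_vector_imp_hypercyclic_vector
        reit_hypercyclic_vector_direct_sum_op_component)
qed

end
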